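(* Let $S$ be a countable universal locally finite semigroup and let $T$ be a finite semigroup. If $\mathrm{Aut}(S)$ acts homogeneously on copies of $T$, then $T$ belongs to the class $\mathcal{B}$ of all amalgamation bases for finite semigroups.
   Context: A semigroup is universal if every finite semigroup embeds in it, and locally finite if every finitely generated subsemigroup is finite. $\mathrm{Aut}(S)$ acts homogeneously on copies of $T$ if for all subsemigroups $T_1,T_2\le S$ with $T_1\cong T\cong T_2$, every isomorphism $T_1\to T_2$ extends to an automorphism of $S$. A finite semigroup $A_0$ is an amalgamation base for finite semigroups if for all finite semigroups $A_1,A_2$ and embeddings (injective homomorphisms) $f_1:A_0\to A_1$, $f_2:A_0\to A_2$ there exist a finite semigroup $B$ and embeddings $g_1:A_1\to B$, $g_2:A_2\to B$ with $f_1g_1=f_2g_2$ (maps composed left to right). *)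

theory Defs
  imports "HOL-Algebra.Group" "HOL-Library.Countable_Set"
begin

text \<open>
  Semigroups are represented by the records of HOL-Algebra, so that \<^const>\<open>hom\<close>, \<^const>\<open>iso\<close>,
  \<^const>\<open>mon\<close> (injective homomorphisms) and \<^const>\<open>is_iso\<close> can be used; none of these refers
  to the unit field of the record, and its value is irrelevant and unconstrained throughout.
  Semigroups and subsemigroups are nonempty.
\<close>

locale semigrp =
  fixes G (structure)
  assumes carrier_nonempty: "carrier G \<noteq> {}"
    and m_closed: "\<lbrakk>x \<in> carrier G; y \<in> carrier G\<rbrakk> \<Longrightarrow> x \<otimes> y \<in> carrier G"
    and m_assoc: "\<lbrakk>x \<in> carrier G; y \<in> carrier G; z \<in> carrier G\<rbrakk>
      \<Longrightarrow> (x \<otimes> y) \<otimes> z = x \<otimes> (y \<otimes> z)"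

definition finite_semigrp :: "('a, 'm) monoid_scheme \<Rightarrow> bool" where
  "finite_semigrp G \<longleftrightarrow> semigrp G \<and> finite (carrier G)"

definition subsemigrp :: "'a set \<Rightarrow> ('a, 'm) monoid_scheme \<Rightarrow> bool" where
  "subsemigrp U S \<longleftrightarrow> U \<noteq> {} \<and> U \<subseteq> carrier S \<and> (\<forall>x\<in>U. \<forall>y\<in>U. x \<otimes>\<^bsub>S\<^esub> y \<in> U)"

inductive_set semigrp_span :: "('a, 'm) monoid_scheme \<Rightarrow> 'a set \<Rightarrow> 'a set"
  for S and X where
    incl: "x \<in> X \<Longrightarrow> x \<in> semigrp_span S X"
  | mult: "\<lbrakk>x \<in> semigrp_span S X; y \<in> semigrp_span S X\<rbrakk> \<Longrightarrow> x \<otimes>\<^bsub>S\<^esub> y \<in> semigrp_span S X"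

definition locally_finite :: "('a, 'm) monoid_scheme \<Rightarrow> bool" where
  "locally_finite S \<longleftrightarrow> (\<forall>X \<subseteq> carrier S. finite X \<longrightarrow> finite (semigrp_span S X))"

text \<open>
  ``All finite semigroups'' is rendered by all finite semigroups whose elements are natural
  numbers. Every finite semigroup is isomorphic to one of these; the lemmas below show that
  nothing depends on this choice.
\<close>

definition universal :: "('a, 'm) monoid_scheme \<Rightarrow> bool" where
  "universal S \<longleftrightarrow> (\<forall>A :: nat monoid. finite_semigrp A \<longrightarrow> (\<exists>f. f \<in> mon A S))"

definition amalgamation_base :: "('a, 'm) monoid_scheme \<Rightarrow> bool" where
  "amalgamation_base A0 \<longleftrightarrow> finite_semigrp A0 \<and>
     (\<forall>(A1 :: nat monoid) (A2 :: nat monoid) f1 f2.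
        finite_semigrp A1 \<longrightarrow> finite_semigrp A2 \<longrightarrow> f1 \<in> mon A0 A1 \<longrightarrow> f2 \<in> mon A0 A2 \<longrightarrow>
        (\<exists>(B :: nat monoid) g1 g2.
           finite_semigrp B \<and> g1 \<in> mon A1 B \<and> g2 \<in> mon A2 B \<and>
           (\<forall>x\<in>carrier A0. g1 (f1 x) = g2 (f2 x))))"

definition aut_homogeneous_on_copies ::
    "('a, 'm) monoid_scheme \<Rightarrow> ('b, 'n) monoid_scheme \<Rightarrow> bool" where
  "aut_homogeneous_on_copies S T \<longleftrightarrow>
     (\<forall>T1 T2. subsemigrp T1 S \<longrightarrow> subsemigrp T2 S \<longrightarrow>
        S\<lparr>carrier := T1\<rparr> \<cong> T \<longrightarrow> T \<cong> S\<lparr>carrier := T2\<rparr> \<longrightarrow>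
        (\<forall>\<psi> \<in> iso (S\<lparr>carrier := T1\<rparr>) (S\<lparr>carrier := T2\<rparr>).
           \<exists>\<phi> \<in> iso S S. \<forall>x\<in>T1. \<phi> x = \<psi> x))"

lemma mon_comp: "\<lbrakk>f \<in> mon A B; g \<in> mon B C\<rbrakk> \<Longrightarrow> (\<lambda>x. g (f x)) \<in> mon A C"
  unfolding mon_def hom_def inj_on_def Pi_def by auto

lemma finite_semigrp_nat_copy:
  assumes "finite_semigrp (A :: ('a, 'm) monoid_scheme)"
  shows "\<exists>(N :: nat monoid) h k. finite_semigrp N \<and> h \<in> mon A N \<and> k \<in> mon N A \<and>
           (\<forall>x\<in>carrier A. k (h x) = x)"
proof -
  interpret semigrp A using assms unfolding finite_semigrp_def by blast
  have fin: "finite (carrier A)" using assms unfolding finite_semigrp_def by blast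
  obtain h :: "'a \<Rightarrow> nat" where inj: "inj_on h (carrier A)"
    using fin countable_finite unfolding countable_def by blast
  define k where "k = inv_into (carrier A) h"
  have kh: "k (h x) = x" if "x \<in> carrier A" for x
    using inv_into_f_f[OF inj that] by (simp add: k_def)
  define N :: "nat monoid" where
    "N = \<lparr>carrier = h ` carrier A, mult = (\<lambda>x y. h (k x \<otimes>\<^bsub>A\<^esub> k y)), one = 0\<rparr>"
  have "semigrp N"
    using carrier_nonempty by unfold_locales (auto simp: N_def kh m_closed m_assoc)
  then have "finite_semigrp N" using fin by (simp add: finite_semigrp_def N_def)
  moreover have "h \<in> mon A N" using inj by (simp add: mon_def hom_def N_def kh Pi_def)
  moreover have "k \<in> mon N A"
    by (auto simp: mon_def hom_def N_def kh m_closed inj_on_def Pi_def)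
  ultimately show ?thesis using kh by blast
qed

lemma universal_mon:
  fixes S :: "('a, 'm) monoid_scheme" and A :: "('b, 'n) monoid_scheme"
  assumes "universal S" "finite_semigrp A"
  shows "\<exists>f. f \<in> mon A S"
proof -
  obtain N :: "nat monoid" and h where N: "finite_semigrp N" "h \<in> mon A N"
    using finite_semigrp_nat_copy[OF assms(2)] by blast
  then obtain f where "f \<in> mon N S" using assms(1) unfolding universal_def by blast
  with N show ?thesis using mon_comp by blast
qed

lemma amalgamation_baseD:
  fixes A0 :: "('a, 'm) monoid_scheme" and A1 :: "('b, 'n) monoid_scheme"
    and A2 :: "('c, 'k) monoid_scheme"
  assumes "amalgamation_base A0" "finite_semigrp A1" "finite_semigrp A2"
    and f: "f1 \<in> mon A0 A1" "f2 \<in> mon A0 A2"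
  shows "\<exists>(B :: nat monoid) g1 g2. finite_semigrp B \<and> g1 \<in> mon A1 B \<and> g2 \<in> mon A2 B \<and>
           (\<forall>x\<in>carrier A0. g1 (f1 x) = g2 (f2 x))"
proof -
  obtain N1 :: "nat monoid" and h1 where N1: "finite_semigrp N1" "h1 \<in> mon A1 N1"
    using finite_semigrp_nat_copy[OF assms(2)] by blast
  obtain N2 :: "nat monoid" and h2 where N2: "finite_semigrp N2" "h2 \<in> mon A2 N2"
    using finite_semigrp_nat_copy[OF assms(3)] by blast
  obtain B :: "nat monoid" and g1 g2 where B: "finite_semigrp B" "g1 \<in> mon N1 B" "g2 \<in> mon N2 B"
    "\<forall>x\<in>carrier A0. g1 (h1 (f1 x)) = g2 (h2 (f2 x))"
    using assms(1)[unfolded amalgamation_base_def, THEN conjunct2, rule_format,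
        OF N1(1) N2(1) mon_comp[OF f(1) N1(2)] mon_comp[OF f(2) N2(2)]] by blast
  show ?thesis using B mon_comp[OF N1(2) B(2)] mon_comp[OF N2(2) B(3)] by blast
qed

lemma amalgamation_baseI:
  fixes A0 :: "('a, 'm) monoid_scheme"
  assumes "finite_semigrp A0"
    and "\<And>(A1 :: nat monoid) (A2 :: nat monoid) f1 f2.
      \<lbrakk>finite_semigrp A1; finite_semigrp A2; f1 \<in> mon A0 A1; f2 \<in> mon A0 A2\<rbrakk> \<Longrightarrow>
      \<exists>(B :: ('b, 'n) monoid_scheme) g1 g2. finite_semigrp B \<and> g1 \<in> mon A1 B \<and> g2 \<in> mon A2 B \<and>
        (\<forall>x\<in>carrier A0. g1 (f1 x) = g2 (f2 x))"
  shows "amalgamation_base A0"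
  unfolding amalgamation_base_def
proof (intro conjI allI impI)
  fix A1 A2 :: "nat monoid" and f1 f2
  assume "finite_semigrp A1" "finite_semigrp A2" "f1 \<in> mon A0 A1" "f2 \<in> mon A0 A2"
  then obtain B :: "('b, 'n) monoid_scheme" and g1 g2
    where B: "finite_semigrp B" "g1 \<in> mon A1 B" "g2 \<in> mon A2 B"
      "\<forall>x\<in>carrier A0. g1 (f1 x) = g2 (f2 x)"
    using assms(2) by blast
  obtain N :: "nat monoid" and h where N: "finite_semigrp N" "h \<in> mon B N"
    using finite_semigrp_nat_copy[OF B(1)] by blast
  have "\<forall>x\<in>carrier A0. h (g1 (f1 x)) = h (g2 (f2 x))" using B(4) by simp
  with N(1) mon_comp[OF B(2) N(2)] mon_comp[OF B(3) N(2)]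
  show "\<exists>(B :: nat monoid) g1 g2. finite_semigrp B \<and> g1 \<in> mon A1 B \<and> g2 \<in> mon A2 B \<and>
      (\<forall>x\<in>carrier A0. g1 (f1 x) = g2 (f2 x))"
    by (intro exI conjI)
qed (fact assms(1))

end

theory Submission
  imports Defs
begin

text \<open>
  Let \<open>f\<^sub>1\<close> and \<open>f\<^sub>2\<close> embed \<open>T\<close> in finite semigroups \<open>A\<^sub>1\<close> and \<open>A\<^sub>2\<close>. By universality there are
  embeddings \<open>e\<^sub>1\<close> and \<open>e\<^sub>2\<close> of \<open>A\<^sub>1\<close> and \<open>A\<^sub>2\<close> in \<open>S\<close>, so that \<open>S\<close> contains two copies of \<open>T\<close>, one
  inside the image of \<open>A\<^sub>1\<close> and one inside the image of \<open>A\<^sub>2\<close>. Sending \<open>e\<^sub>1 (f\<^sub>1 x)\<close> to \<open>e\<^sub>2 (f\<^sub>2 x)\<close> is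
  an isomorphism between the copies (\<open>iso_between_images\<close>), which by homogeneity extends to an
  automorphism \<open>\<phi>\<close> of \<open>S\<close>. Moving the copy of \<open>A\<^sub>1\<close> by \<open>\<phi>\<close> glues it to the copy of \<open>A\<^sub>2\<close> along
  \<open>T\<close>: the embeddings \<open>\<phi> \<circ> e\<^sub>1\<close> and \<open>e\<^sub>2\<close> agree on \<open>T\<close>. The amalgam is the subsemigroup
  generated by the two images, which is finite because \<open>S\<close> is locally finite
  (\<open>joint_embedding_in_finite_subsemigrp\<close>).
\<close>

lemma subsemigrp_image_mon:
  assumes "semigrp A" and "f \<in> mon A S"
  shows "subsemigrp (f ` carrier A) S"
  unfolding subsemigrp_def
proof (intro conjI ballI)
  show "f ` carrier A \<noteq> {}" using semigrp.carrier_nonempty[OF assms(1)] by simp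
  show "f ` carrier A \<subseteq> carrier S" using assms(2) by (auto simp: mon_def hom_def)
  fix u v assume "u \<in> f ` carrier A" "v \<in> f ` carrier A"
  then obtain x y where xy: "x \<in> carrier A" "y \<in> carrier A" "u = f x" "v = f y" by blast
  then have "u \<otimes>\<^bsub>S\<^esub> v = f (x \<otimes>\<^bsub>A\<^esub> y)" using assms(2) by (simp add: mon_def hom_def)
  then show "u \<otimes>\<^bsub>S\<^esub> v \<in> f ` carrier A" using semigrp.m_closed[OF assms(1)] xy by simp
qed

lemma mon_iso_onto_image:
  assumes "f \<in> mon A S"
  shows "f \<in> iso A (S\<lparr>carrier := f ` carrier A\<rparr>)"
  using assms by (auto simp: mon_def iso_def hom_def bij_betw_def)

lemma inv_into_mon_iso:
  assumes "semigrp A" and "f \<in> mon A S"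
  shows "inv_into (carrier A) f \<in> iso (S\<lparr>carrier := f ` carrier A\<rparr>) A"
proof -
  have inj: "inj_on f (carrier A)"
    and hom: "\<And>x y. \<lbrakk>x \<in> carrier A; y \<in> carrier A\<rbrakk> \<Longrightarrow> f x \<otimes>\<^bsub>S\<^esub> f y = f (x \<otimes>\<^bsub>A\<^esub> y)"
    using assms(2) by (auto simp: mon_def hom_def)
  have "bij_betw (inv_into (carrier A) f) (f ` carrier A) (carrier A)"
    using inj by (simp add: bij_betw_imageI bij_betw_inv_into)
  then show ?thesis
    using inj by (auto simp: iso_def hom_def hom semigrp.m_closed[OF assms(1)] inv_into_f_f)
qed

lemma iso_between_images:
  assumes "semigrp A" and "f \<in> mon A S" and "g \<in> mon A S"
  shows "(\<lambda>u. g (inv_into (carrier A) f u))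
           \<in> iso (S\<lparr>carrier := f ` carrier A\<rparr>) (S\<lparr>carrier := g ` carrier A\<rparr>)"
  using iso_set_trans[OF inv_into_mon_iso[OF assms(1,2)] mon_iso_onto_image[OF assms(3)]]
  by (simp add: comp_def)

lemma semigrp_span_subset_carrier:
  assumes "semigrp S" and "X \<subseteq> carrier S"
  shows "semigrp_span S X \<subseteq> carrier S"
proof
  fix u assume "u \<in> semigrp_span S X"
  then show "u \<in> carrier S"
    by induction (use assms(2) semigrp.m_closed[OF assms(1)] in auto)
qed

lemma semigrp_semigrp_span:
  assumes "semigrp S" and "X \<subseteq> carrier S" and "X \<noteq> {}"
  shows "semigrp (S\<lparr>carrier := semigrp_span S X\<rparr>)"
proof
  show "carrier (S\<lparr>carrier := semigrp_span S X\<rparr>) \<noteq> {}"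
    using assms(3) by (auto intro: semigrp_span.incl)
qed (use semigrp_span_subset_carrier[OF assms(1,2)] in
      \<open>auto intro: semigrp_span.mult semigrp.m_assoc[OF assms(1)]\<close>)

text \<open>
  The two images together form a finite set, so \<open>U\<close> can be taken to be its span.
\<close>

lemma joint_embedding_in_finite_subsemigrp:
  assumes S: "semigrp S" "locally_finite S"
    and A: "finite_semigrp A1" "finite_semigrp A2"
    and g: "g1 \<in> mon A1 S" "g2 \<in> mon A2 S"
  obtains U where "finite_semigrp (S\<lparr>carrier := U\<rparr>)"
    and "g1 \<in> mon A1 (S\<lparr>carrier := U\<rparr>)" and "g2 \<in> mon A2 (S\<lparr>carrier := U\<rparr>)"
proof -
  define X where "X = g1 ` carrier A1 \<union> g2 ` carrier A2"
  have X: "X \<subseteq> carrier S" using g by (auto simp: X_def mon_def hom_def)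
  have "X \<noteq> {}"
    using A(1) semigrp.carrier_nonempty by (auto simp: X_def finite_semigrp_def)
  moreover have "finite X" using A by (simp add: X_def finite_semigrp_def)
  ultimately have "finite_semigrp (S\<lparr>carrier := semigrp_span S X\<rparr>)"
    using semigrp_semigrp_span[OF S(1) X] S(2) X
    by (simp add: finite_semigrp_def locally_finite_def)
  moreover have "g1 \<in> mon A1 (S\<lparr>carrier := semigrp_span S X\<rparr>)"
      "g2 \<in> mon A2 (S\<lparr>carrier := semigrp_span S X\<rparr>)"
    using g by (auto simp: mon_def hom_def X_def intro: semigrp_span.incl)
  ultimately show thesis using that by blast
qed

theorem proposition3p1:
  fixes S :: "('a, 'm) monoid_scheme" and T :: "('b, 'n) monoid_scheme"
  assumes "semigrp S" and "countable (carrier S)" and "universal S" and "locally_finite S"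
    and "finite_semigrp T"
    and "aut_homogeneous_on_copies S T"
  shows "amalgamation_base T"
proof (rule amalgamation_baseI[OF assms(5)])
  fix A1 A2 :: "nat monoid" and f1 f2
  assume A: "finite_semigrp A1" "finite_semigrp A2"
    and f: "f1 \<in> mon T A1" "f2 \<in> mon T A2"
  obtain e1 where e1: "e1 \<in> mon A1 S" using universal_mon[OF assms(3) A(1)] by blast
  obtain e2 where e2: "e2 \<in> mon A2 S" using universal_mon[OF assms(3) A(2)] by blast
  define h1 where "h1 = (\<lambda>x. e1 (f1 x))"
  define h2 where "h2 = (\<lambda>x. e2 (f2 x))"
  have h: "h1 \<in> mon T S" "h2 \<in> mon T S"
    using mon_comp[OF f(1) e1] mon_comp[OF f(2) e2] by (simp_all add: h1_def h2_def)
  have T: "semigrp T" using assms(5) by (simp add: finite_semigrp_def)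
  let ?T1 = "h1 ` carrier T" and ?T2 = "h2 ` carrier T"
  let ?\<psi> = "\<lambda>u. h2 (inv_into (carrier T) h1 u)"
  have copies: "S\<lparr>carrier := ?T1\<rparr> \<cong> T" "T \<cong> S\<lparr>carrier := ?T2\<rparr>"
    using inv_into_mon_iso[OF T h(1)] mon_iso_onto_image[OF h(2)]
    by (auto simp: is_iso_def)
  have "\<forall>\<psi>\<in>iso (S\<lparr>carrier := ?T1\<rparr>) (S\<lparr>carrier := ?T2\<rparr>). \<exists>\<phi>\<in>iso S S. \<forall>u\<in>?T1. \<phi> u = \<psi> u"
    using assms(6) subsemigrp_image_mon[OF T h(1)] subsemigrp_image_mon[OF T h(2)] copies
    unfolding aut_homogeneous_on_copies_def by blast
  from bspec[OF this iso_between_images[OF T h]]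
  obtain \<phi> where \<phi>: "\<phi> \<in> iso S S" and ext: "\<forall>u\<in>?T1. \<phi> u = ?\<psi> u"
    by blast
  have inj: "inj_on h1 (carrier T)" using h(1) by (simp add: mon_def)
  have "\<forall>x\<in>carrier T. \<phi> (h1 x) = h2 x" using ext by (simp add: inv_into_f_f[OF inj])
  then have agree: "\<forall>x\<in>carrier T. \<phi> (e1 (f1 x)) = e2 (f2 x)"
    unfolding h1_def h2_def .
  have "\<phi> \<in> mon S S" using \<phi> by (simp add: iso_def mon_def bij_betw_def)
  with e1 have "(\<lambda>x. \<phi> (e1 x)) \<in> mon A1 S" by (rule mon_comp)
  from joint_embedding_in_finite_subsemigrp[OF assms(1,4) A this e2]
  obtain U where "finite_semigrp (S\<lparr>carrier := U\<rparr>)"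
      "(\<lambda>x. \<phi> (e1 x)) \<in> mon A1 (S\<lparr>carrier := U\<rparr>)" "e2 \<in> mon A2 (S\<lparr>carrier := U\<rparr>)"
    .
  with agree show "\<exists>(B :: ('a, 'm) monoid_scheme) g1 g2. finite_semigrp B \<and>
      g1 \<in> mon A1 B \<and> g2 \<in> mon A2 B \<and> (\<forall>x\<in>carrier T. g1 (f1 x) = g2 (f2 x))"
    by (intro exI conjI)
qed

end
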